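(* Let $m\ge 1$ and let $A_1,\dots,A_m$ be a reduced set of patterns over a finite alphabet $\Omega$, of lengths $l_1,\dots,l_m$, and let $Q_\tau(s)$ and $g_\tau^{A_1}(s),\dots,g_\tau^{A_m}(s)$ be the associated generating functions (tail generating function of $\tau$, and generating functions of the events that $A_i$ is the first pattern to appear). The solution $(Q_\tau(s),g_\tau^{A_1}(s),\dots,g_\tau^{A_m}(s))$ of the system of linear equations $$ \left\{ \begin{array}{ccl} (1-s)Q_\tau(s)+\sum_{j=1}^m g_\tau^{A_j}(s) & = & 1,\\ Pr(A_i)s^{l_i}Q_\tau(s)-\sum_{j=1}^m w_{A_i}^{A_j}(s)\,g_\tau^{A_j}(s) & = & 0\quad (1\le i \le m) \end{array} \right. $$ has, for $s$ in a neighbourhood of $0$, the form $$ g_\tau^{A_i}(s)=\frac{\det \mathcal{B}^i(s)}{\sum_{j=1}^{m}\det \mathcal{B}^j(s)+(1-s)\det \mathcal{B}(s)}\quad(1\le i \le m) $$ and $$ Q_\tau(s)=\frac{\det \mathcal{B}(s)}{\sum_{j=1}^{m}\det \mathcal{B}^j(s)+(1-s)\det \mathcal{B}(s)}, $$ where $\mathcal{B}(s)=[w_{A_i}^{A_j}(s)]_{1\le i,j\le m}$ (row index $i$, column index $j$) and $\mathcal{B}^j(s)$ is the matrix obtained by replacing the $j$-th column of $\mathcal{B}(s)$ by the column vector $[Pr(A_i)s^{l_i}]_{1\le i\le m}$.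
   Context: Let $(\xi_n)_{n\ge1}$ be a sequence of i.i.d. random letters from a finite alphabet $\Omega$. For a pattern (word) $A=(a_1,\dots,a_l)\in\Omega^l$, $l\ge 1$, put $Pr(A)=\prod_{k=1}^l Pr(\xi_1=a_k)$; $A_{(k)}=(a_1,\dots,a_k)$ and $A^{(k)}=(a_{l-k+1},\dots,a_l)$ denote the words formed by its first and last $k$ letters, and $Pr(A^{(0)})=1$. For words $U,V$, $[U=V]$ is $1$ if $U=V$ and $0$ otherwise. For patterns $A$, $B$ of lengths $l$, $m'$, the correlation polynomial is $$w_A^B(s)=\sum_{k=1}^{\min\{l,m'\}}[A_{(k)}=B^{(k)}]\,Pr(A^{(l-k)})\,s^{l-k}.$$ A set of $m$ patterns $A_1,\dots,A_m$ of lengths $l_1,\dots,l_m$ is reduced if none of the patterns contains any other as a subpattern (i.e. as a block of consecutive letters). Let $\tau_i$ be the stopping time until $A_i$ occurs, i.e. the least $n\ge l_i$ with $(\xi_{n-l_i+1},\dots,\xi_n)=A_i$, and $\tau=\min\{\tau_i:1\le i\le m\}$. Put $p_n^{A_i}=Pr(\tau=\tau_i=n)$ and $q_n=Pr(\tau>n)$ for $n\ge 0$, and $$g_\tau^{A_i}(s)=\sum_{n=0}^\infty p_n^{A_i}s^n,\qquad Q_\tau(s)=\sum_{n=0}^\infty q_n s^n .$$ These generating functions satisfy the linear system displayed in the claim (Guibas and Odlyzko). *)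

theory Defs
  imports "HOL-Probability.Probability" "HOL-Library.Sublist" "HOL-Library.Extended_Nat"
begin

definition first_letters :: "nat \<Rightarrow> 'a list \<Rightarrow> 'a list" where
  "first_letters k A = take k A"

definition last_letters :: "nat \<Rightarrow> 'a list \<Rightarrow> 'a list" where
  "last_letters k A = drop (length A - k) A"

text \<open>The letters are \<open>\<xi> 1, \<xi> 2, \<dots>\<close>; the value \<open>\<xi> 0\<close> is never used.\<close>

definition word_prob :: "'w measure \<Rightarrow> (nat \<Rightarrow> 'w \<Rightarrow> 'a) \<Rightarrow> 'a list \<Rightarrow> real" where
  "word_prob M \<xi> A = (\<Prod>k<length A. measure M {\<omega> \<in> space M. \<xi> 1 \<omega> = A ! k})"

text \<open>\<open>corr_poly M \<xi> A B s\<close> is the value at \<open>s\<close> of the correlation polynomial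
  with lower index \<open>A\<close> and upper index \<open>B\<close>.\<close>

definition corr_poly ::
  "'w measure \<Rightarrow> (nat \<Rightarrow> 'w \<Rightarrow> 'a) \<Rightarrow> 'a list \<Rightarrow> 'a list \<Rightarrow> complex \<Rightarrow> complex" where
  "corr_poly M \<xi> A B s =
    (\<Sum>k = 1..min (length A) (length B).
       of_bool (first_letters k A = last_letters k B)
         * of_real (word_prob M \<xi> (last_letters (length A - k) A)) * s ^ (length A - k))"

text \<open>The indexing by a family also excludes repeated patterns.\<close>

definition reduced_patterns :: "('m \<Rightarrow> 'a list) \<Rightarrow> bool" where
  "reduced_patterns A \<longleftrightarrow> (\<forall>i j. i \<noteq> j \<longrightarrow> \<not> sublist (A i) (A j))"

text \<open>The infimum of the empty set is \<open>\<infinity>\<close>: the pattern never occurs.\<close>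

definition pattern_time :: "(nat \<Rightarrow> 'w \<Rightarrow> 'a) \<Rightarrow> 'a list \<Rightarrow> 'w \<Rightarrow> enat" where
  "pattern_time \<xi> A \<omega> =
    (INF n \<in> {n. length A \<le> n \<and> map (\<lambda>k. \<xi> k \<omega>) [n - length A + 1..<n + 1] = A}. enat n)"

definition first_pattern_time ::
  "(nat \<Rightarrow> 'w \<Rightarrow> 'a) \<Rightarrow> ('m::finite \<Rightarrow> 'a list) \<Rightarrow> 'w \<Rightarrow> enat" where
  "first_pattern_time \<xi> A \<omega> = Min (range (\<lambda>i. pattern_time \<xi> (A i) \<omega>))"

definition first_pattern_prob ::
  "'w measure \<Rightarrow> (nat \<Rightarrow> 'w \<Rightarrow> 'a) \<Rightarrow> ('m::finite \<Rightarrow> 'a list) \<Rightarrow> 'm \<Rightarrow> nat \<Rightarrow> real" where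
  "first_pattern_prob M \<xi> A i n =
    measure M {\<omega> \<in> space M. first_pattern_time \<xi> A \<omega> = pattern_time \<xi> (A i) \<omega>
                            \<and> pattern_time \<xi> (A i) \<omega> = enat n}"

definition tail_prob ::
  "'w measure \<Rightarrow> (nat \<Rightarrow> 'w \<Rightarrow> 'a) \<Rightarrow> ('m::finite \<Rightarrow> 'a list) \<Rightarrow> nat \<Rightarrow> real" where
  "tail_prob M \<xi> A n = measure M {\<omega> \<in> space M. first_pattern_time \<xi> A \<omega> > enat n}"

text \<open>Both series have coefficients in \<open>[0,1]\<close>, hence converge for \<open>norm s < 1\<close>.\<close>

definition pattern_gf ::
  "'w measure \<Rightarrow> (nat \<Rightarrow> 'w \<Rightarrow> 'a) \<Rightarrow> ('m::finite \<Rightarrow> 'a list) \<Rightarrow> 'm \<Rightarrow> complex \<Rightarrow> complex" where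
  "pattern_gf M \<xi> A i s = (\<Sum>n. of_real (first_pattern_prob M \<xi> A i n) * s ^ n)"

definition tail_gf ::
  "'w measure \<Rightarrow> (nat \<Rightarrow> 'w \<Rightarrow> 'a) \<Rightarrow> ('m::finite \<Rightarrow> 'a list) \<Rightarrow> complex \<Rightarrow> complex" where
  "tail_gf M \<xi> A s = (\<Sum>n. of_real (tail_prob M \<xi> A n) * s ^ n)"

definition guibas_odlyzko_system ::
  "'w measure \<Rightarrow> (nat \<Rightarrow> 'w \<Rightarrow> 'a) \<Rightarrow> ('m::finite \<Rightarrow> 'a list) \<Rightarrow> complex
    \<Rightarrow> complex \<Rightarrow> ('m \<Rightarrow> complex) \<Rightarrow> bool" where
  "guibas_odlyzko_system M \<xi> A s Q g \<longleftrightarrow>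
    (1 - s) * Q + (\<Sum>j\<in>UNIV. g j) = 1 \<and>
    (\<forall>i. of_real (word_prob M \<xi> (A i)) * s ^ length (A i) * Q
          - (\<Sum>j\<in>UNIV. corr_poly M \<xi> (A i) (A j) s * g j) = 0)"

definition corr_matrix ::
  "'w measure \<Rightarrow> (nat \<Rightarrow> 'w \<Rightarrow> 'a) \<Rightarrow> ('m::finite \<Rightarrow> 'a list) \<Rightarrow> complex \<Rightarrow> complex ^ 'm ^ 'm" where
  "corr_matrix M \<xi> A s = (\<chi> i j. corr_poly M \<xi> (A i) (A j) s)"

definition corr_matrix_replaced ::
  "'w measure \<Rightarrow> (nat \<Rightarrow> 'w \<Rightarrow> 'a) \<Rightarrow> ('m::finite \<Rightarrow> 'a list) \<Rightarrow> 'm \<Rightarrow> complex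
    \<Rightarrow> complex ^ 'm ^ 'm" where
  "corr_matrix_replaced M \<xi> A j s =
    (\<chi> i k. if k = j then of_real (word_prob M \<xi> (A i)) * s ^ length (A i)
             else corr_matrix M \<xi> A s $ i $ k)"

end

theory Submission
  imports Defs
begin

text \<open>
  Near \<open>s = 0\<close> the system has exactly one solution, given by Cramer's rule, so everything
  rests on showing that the two generating functions do solve it. That is a statement about their
  coefficients \<open>q n = Pr(\<tau> > n)\<close> and \<open>p j n = Pr(\<tau> = \<tau>\<^sub>j = n)\<close>. Both events are decided by the
  first \<open>n\<close> letters, and by independence a word \<open>w\<close> of length \<open>n\<close> is read with probability
  \<open>Pr(w)\<close>, which is multiplicative under concatenation. Hence \<open>q n\<close> and \<open>p j n\<close> are weights of
  finite sets of words, and two decompositions of such sets give the two kinds of equation.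

  \<^item> Appending one letter to a word that avoids all patterns either preserves avoidance or completes
    exactly one pattern (\<open>one_letter_extension\<close>, \<open>reduced_suffix_unique\<close>), so
    \<open>q n = q (n + 1) + (\<Sum>j. p j (n + 1))\<close>.
  \<^item> Appending the whole pattern \<open>A i\<close> to an avoiding word of length \<open>n\<close> forces some pattern
    to be completed. If \<open>A j\<close> is the first one, after \<open>k\<close> of the new letters, then reducedness
    gives \<open>k \<le> length (A j)\<close>, so that the first \<open>k\<close> letters of \<open>A i\<close> are the last \<open>k\<close> letters
    of \<open>A j\<close>, and the remaining letters of \<open>A i\<close> are independent of what was read before.
    Conversely, every such overlap arises (\<open>pattern_extension\<close>). Therefore \<open>Pr(A i) * q n\<close> is the
    sum of \<open>Pr(drop k (A i)) * p j (n + k)\<close> over all \<open>j\<close> and all overlap lengths \<open>k\<close>, which are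
    the lengths that the correlation polynomial records.

  For the linear algebra, write \<open>B\<close> for the correlation matrix and \<open>v\<close> for the vector with entries
  \<open>Pr(A i) * s ^ length (A i)\<close>. The second family of equations is \<open>B g = Q v\<close>, whence
  \<open>g\<^sub>j det B = Q det B\<^sup>j\<close>, where \<open>B\<^sup>j\<close> has \<open>v\<close> in place of the \<open>j\<close>-th column of \<open>B\<close>;
  multiplying the first equation by \<open>det B\<close> then gives
  \<open>det B = Q D\<close> with \<open>D\<close> the common denominator. At \<open>s = 0\<close> reducedness makes \<open>B\<close> the identity
  and \<open>v\<close> vanishes, so \<open>det B\<close> and \<open>D\<close> equal \<open>1\<close> there and by continuity are nonzero nearby.
\<close>

section \<open>Words that avoid a set of patterns\<close>

definition avoids :: "('m \<Rightarrow> 'a list) \<Rightarrow> 'a list \<Rightarrow> bool" where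
  "avoids A w \<longleftrightarrow> (\<forall>i. \<not> sublist (A i) w)"

definition avoiding_words :: "('m \<Rightarrow> 'a list) \<Rightarrow> nat \<Rightarrow> 'a list set" where
  "avoiding_words A n = {w. length w = n \<and> avoids A w}"

text \<open>Since the word without its last letter avoids every pattern, the final occurrence of
  \<open>A j\<close> is the first occurrence of any pattern.\<close>

definition first_hit_words :: "('m \<Rightarrow> 'a list) \<Rightarrow> 'm \<Rightarrow> nat \<Rightarrow> 'a list set" where
  "first_hit_words A j n = {w. length w = n \<and> suffix (A j) w \<and> avoids A (butlast w)}"

lemma avoids_prefix: "avoids A w \<Longrightarrow> prefix u w \<Longrightarrow> avoids A u"
  unfolding avoids_def
  using prefix_imp_sublist sublist_order.order_trans by blast

text \<open>An occurrence of a pattern inside \<open>w\<close> is an occurrence at the end of a prefix of \<open>w\<close>;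
  this translates avoidance into the absence of pattern times up to the length of \<open>w\<close>.\<close>

lemma avoids_iff_prefixes: "avoids A w \<longleftrightarrow> (\<forall>m\<le>length w. \<forall>i. \<not> suffix (A i) (take m w))"
proof -
  have pre: "prefix v w \<longleftrightarrow> (\<exists>m\<le>length w. v = take m w)" for v
  proof
    assume "prefix v w"
    then show "\<exists>m\<le>length w. v = take m w"
      by (intro exI[of _ "length v"]) (auto simp: prefix_def)
  qed (auto simp: take_is_prefix)
  have "sublist u w \<longleftrightarrow> (\<exists>m\<le>length w. suffix u (take m w))" for u
    by (auto simp: sublist_altdef pre)
  then show ?thesis by (auto simp: avoids_def)
qed

text \<open>Of two patterns ending at the same place, the shorter one is a block of the longer one.
  Hence at most one pattern of a reduced set is completed at a time.\<close>

lemma reduced_suffix_unique: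
  assumes "reduced_patterns A" "suffix (A i) w" "suffix (A j) w"
  shows "i = j"
proof (rule ccontr)
  assume "i \<noteq> j"
  then have "\<not> sublist (A i) (A j)" "\<not> sublist (A j) (A i)"
    using assms(1) by (simp_all add: reduced_patterns_def)
  then show False using suffix_same_cases[OF assms(2,3)] by auto
qed

lemma finite_words: "finite {w :: 'a::finite list. length w = n \<and> P w}"
proof -
  have "finite {w :: 'a list. set w \<subseteq> UNIV \<and> length w = n}"
    by (intro finite_lists_length_eq) simp
  then show ?thesis by (rule rev_finite_subset) auto
qed

lemma finite_avoiding_words [simp]: "finite (avoiding_words A n :: 'a::finite list set)"
  and finite_first_hit_words [simp]: "finite (first_hit_words A j n :: 'a::finite list set)"
  unfolding avoiding_words_def first_hit_words_def by (rule finite_words)+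

lemma first_hit_words_disjoint:
  assumes "reduced_patterns A" "w \<in> first_hit_words A i n" "w \<in> first_hit_words A j n"
  shows "i = j"
  using assms(2,3) by (auto simp: first_hit_words_def intro: reduced_suffix_unique[OF assms(1)])

lemma first_hit_words_short:
  assumes "n < length (A j)"
  shows "first_hit_words A j n = {}"
  using assms by (auto simp: first_hit_words_def dest: suffix_length_le)

text \<open>A pattern that appears when a letter is added must end in that letter.\<close>

lemma one_letter_extension:
  "(\<lambda>(u, a). u @ [a]) ` (avoiding_words A n \<times> UNIV) =
    avoiding_words A (Suc n) \<union> (\<Union>j. first_hit_words A j (Suc n))" (is "?L = ?R")
proof (intro set_eqI iffI)
  fix w assume "w \<in> ?L"
  then obtain u a where w: "w = u @ [a]" and u: "length u = n" "avoids A u"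
    by (auto simp: avoiding_words_def)
  show "w \<in> ?R"
  proof (cases "avoids A w")
    case True
    then show ?thesis using w u by (simp add: avoiding_words_def)
  next
    case False
    then obtain i v where "prefix v (u @ [a])" "suffix (A i) v"
      unfolding avoids_def w sublist_altdef by blast
    moreover have "\<not> prefix v u"
      using u(2) \<open>suffix (A i) v\<close> unfolding avoids_def sublist_altdef by blast
    ultimately have "suffix (A i) w" unfolding w by simp
    then show ?thesis using w u by (auto simp: first_hit_words_def)
  qed
next
  fix w assume r: "w \<in> ?R"
  then have len: "length w = Suc n" by (auto simp: avoiding_words_def first_hit_words_def)
  have "avoids A (butlast w)"
    using r avoids_prefix[OF _ prefixeq_butlast] by (auto simp: avoiding_words_def first_hit_words_def)
  moreover have "w = butlast w @ [last w]" using len by (cases w rule: rev_cases) auto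
  ultimately show "w \<in> ?L"
    using len by (auto simp: avoiding_words_def image_iff intro!: exI[of _ "butlast w"] exI[of _ "last w"])
qed

lemma one_letter_extension_disjoint:
  "avoiding_words A n \<inter> first_hit_words A j n = {}"
  by (auto simp: avoiding_words_def first_hit_words_def avoids_def)

section \<open>Appending a whole pattern\<close>

text \<open>The lengths \<open>k\<close> that contribute a monomial to the correlation polynomial.\<close>

definition overlaps :: "'a list \<Rightarrow> 'a list \<Rightarrow> nat set" where
  "overlaps A B = {k \<in> {1..min (length A) (length B)}. first_letters k A = last_letters k B}"

lemma corr_poly_eq_sum_overlaps:
  "corr_poly M \<xi> B C s =
    (\<Sum>k\<in>overlaps B C. of_real (word_prob M \<xi> (drop k B)) * s ^ (length B - k))"
  unfolding corr_poly_def overlaps_def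
  by (subst sum.inter_filter) (auto intro!: sum.cong simp: last_letters_def)

lemma suffix_append_overlap:
  assumes "k \<in> overlaps B C" "suffix C w"
  shows "\<exists>u. w = u @ take k B"
proof -
  from assms(2) obtain v where "w = v @ C" by (auto simp: suffix_def)
  moreover have "C = take (length C - k) C @ take k B"
    using assms(1) by (auto simp: overlaps_def first_letters_def last_letters_def)
  ultimately show ?thesis by (metis append.assoc)
qed

text \<open>Reading \<open>A i\<close> after an avoiding word \<open>u\<close>, stop as soon as some pattern \<open>A j\<close> is completed, say
  after \<open>k\<close> letters; at the latest this happens at the end of \<open>A i\<close>. The occurrence of \<open>A j\<close> cannot
  lie in \<open>A i\<close> with a letter of \<open>A i\<close> to spare before it, because the patterns are reduced. So it covers
  those \<open>k\<close> letters, which is an overlap. In the other direction, the overlap supplies the first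
  \<open>k\<close> letters of \<open>A i\<close>, and what precedes them avoids all patterns because the hit is the first.\<close>

lemma pattern_extension:
  assumes red: "reduced_patterns A"
  shows "(\<lambda>u. u @ A i) ` avoiding_words A n =
    (\<Union>(j, k) \<in> (SIGMA j:UNIV. overlaps (A i) (A j)).
       (\<lambda>w. w @ drop k (A i)) ` first_hit_words A j (n + k))" (is "?L = ?R")
proof (intro set_eqI iffI)
  fix x assume "x \<in> ?L"
  then obtain u where x: "x = u @ A i" and u: "length u = n" "avoids A u"
    by (auto simp: avoiding_words_def)
  define hit where "hit k \<longleftrightarrow> (\<exists>j. suffix (A j) (u @ take k (A i)))" for k
  define k where "k = (LEAST k. hit k)"
  have hl: "hit (length (A i))" unfolding hit_def by (auto simp: suffix_def)
  have hk: "hit k" unfolding k_def by (rule LeastI[of hit, OF hl])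
  have kl: "k \<le> length (A i)" unfolding k_def by (rule Least_le[of hit, OF hl])
  have min: "\<not> hit k'" if "k' < k" for k' using not_less_Least that unfolding k_def by blast
  from hk obtain j where j: "suffix (A j) (u @ take k (A i))" unfolding hit_def by blast
  have k0: "k \<noteq> 0"
  proof
    assume "k = 0"
    then have "sublist (A j) u" using suffix_imp_sublist[OF j] by simp
    then show False using u(2) by (simp add: avoids_def)
  qed
  define w where "w = u @ take k (A i)"
  have av: "avoids A (butlast w)"
  proof -
    have bw: "butlast w = u @ take (k - 1) (A i)"
      using k0 kl by (auto simp: w_def butlast_append butlast_take)
    have "\<not> suffix (A j') v" if "prefix v (butlast w)" for v j'
    proof (cases "prefix v u")
      case True
      then show ?thesis using u(2) by (auto simp: avoids_def sublist_altdef)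
    next
      case False
      with that bw obtain v' where v': "v = u @ v'" "prefix v' (take (k - 1) (A i))"
        by (auto simp: prefix_append)
      define m where "m = length v'"
      have "v' = take m (take (k - 1) (A i))" 
        using v'(2) unfolding prefix_def m_def by (metis append_eq_conv_conj)
      moreover have "m \<le> k - 1" using prefix_length_le[OF v'(2)] by (simp add: m_def)
      ultimately have "m \<le> k - 1" "v = u @ take m (A i)" using v'(1) by (simp_all add: min_absorb1)
      then show ?thesis using min[of m] k0 unfolding hit_def by auto
    qed
    then show ?thesis by (auto simp: avoids_def sublist_altdef)
  qed
  have kj: "k \<le> length (A j)"
  proof (rule ccontr)
    \<comment> \<open>Otherwise \<open>A j\<close> fits into the first \<open>k\<close> letters of \<open>A i\<close>, so \<open>j = i\<close>, although \<open>A i\<close> has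
      at least \<open>k\<close> letters.\<close>
    assume n: "\<not> k \<le> length (A j)"
    have "suffix (A j) (take k (A i))"
      by (rule suffix_length_suffix[OF j]) (use n kl in \<open>auto simp: suffix_def\<close>)
    then have "sublist (A j) (A i)"
      using sublist_order.order_trans[OF suffix_imp_sublist sublist_take] by blast
    then have "j = i" using red by (auto simp: reduced_patterns_def)
    then show False using n kl by simp
  qed
  have "suffix (take k (A i)) (A j)"
    by (rule suffix_length_suffix[OF _ j]) (use kj in \<open>auto simp: suffix_def\<close>)
  then have "take k (A i) = drop (length (A j) - k) (A j)"
    using kl kj by (auto simp: suffix_def)
  then have "k \<in> overlaps (A i) (A j)"
    using k0 kl kj by (auto simp: overlaps_def first_letters_def last_letters_def)
  moreover have "w \<in> first_hit_words A j (n + k)"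
    using av j kl u by (simp add: first_hit_words_def w_def)
  moreover have "x = w @ drop k (A i)" by (simp add: x w_def)
  ultimately show "x \<in> ?R" by blast
next
  fix x assume "x \<in> ?R"
  then obtain j k w where k: "k \<in> overlaps (A i) (A j)"
    and w: "w \<in> first_hit_words A j (n + k)" and x: "x = w @ drop k (A i)" by blast
  from w have sw: "suffix (A j) w" and len: "length w = n + k" and av: "avoids A (butlast w)"
    by (auto simp: first_hit_words_def)
  obtain u where u: "w = u @ take k (A i)" using suffix_append_overlap[OF k sw] by blast
  have k1: "1 \<le> k" "k \<le> length (A i)" using k by (auto simp: overlaps_def)
  have "take k (A i) \<noteq> []" using k1 by auto
  then have "prefix u (butlast w)" by (simp add: u butlast_append)
  then have "avoids A u" using av avoids_prefix by blast
  moreover have "length u = n" using len u k1 by simp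
  moreover have "x = u @ A i" by (simp add: x u)
  ultimately show "x \<in> ?L" by (auto simp: avoiding_words_def)
qed

text \<open>First-hit words form a prefix code: a shorter one in front of a longer one would put a pattern
  into the part of the longer word that avoids all patterns. This makes the decomposition in
  \<open>pattern_extension\<close> a disjoint one.\<close>

lemma first_hit_words_prefix_free:
  assumes "w \<in> first_hit_words A j n" "w' \<in> first_hit_words A j' n'" "w @ v = w' @ v'"
  shows "n \<le> n'"
proof (rule ccontr)
  assume "\<not> n \<le> n'"
  then have "length w' < length w" using assms by (simp add: first_hit_words_def)
  moreover from this have "prefix w' w"
    using prefix_length_prefix[of w' "w' @ v'" w] by (simp add: assms(3)[symmetric] prefixI[OF assms(3)])
  moreover have "w = butlast w @ [last w]"
    using \<open>length w' < length w\<close> by (cases w rule: rev_cases) auto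
  ultimately have "prefix w' (butlast w)"
    by (metis less_irrefl prefix_snoc)
  then have "sublist (A j') (butlast w)"
    using assms(2) by (auto simp: first_hit_words_def intro: sublist_order.order_trans)
  then show False using assms(1) by (auto simp: first_hit_words_def avoids_def)
qed

lemma pattern_extension_disjoint:
  assumes red: "reduced_patterns A"
    and "w \<in> first_hit_words A j (n + k)" "w' \<in> first_hit_words A j' (n + k')"
    and eq: "w @ drop k B = w' @ drop k' B"
  shows "j = j' \<and> k = k' \<and> w = w'"
proof -
  have "k = k'"
    using first_hit_words_prefix_free[OF assms(2,3) eq] first_hit_words_prefix_free[OF assms(3,2) eq[symmetric]]
    by simp
  then show ?thesis using eq assms(2,3) first_hit_words_disjoint[OF red] by auto
qed

section \<open>Power series with coefficients in the unit interval\<close>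

lemma summable_gf:
  fixes c :: "nat \<Rightarrow> real" and s :: complex
  assumes "norm s < 1" "\<And>n. 0 \<le> c n" "\<And>n. c n \<le> 1"
  shows "summable (\<lambda>n. of_real (c n) * s ^ n)"
proof (rule summable_comparison_test')
  show "summable (\<lambda>n. norm s ^ n)" using assms(1) by (simp add: summable_geometric)
  show "norm (of_real (c n) * s ^ n) \<le> norm s ^ n" for n
    using assms(2,3)[of n] by (simp add: norm_mult norm_power mult_left_le_one_le)
qed

section \<open>Independent, identically distributed letters\<close>

locale iid_letters = prob_space M for M :: "'w measure" +
  fixes \<xi> :: "nat \<Rightarrow> 'w \<Rightarrow> 'a::finite"
  assumes indep: "indep_vars (\<lambda>_. count_space UNIV) \<xi> {1..}"
    and ident: "n \<ge> 1 \<Longrightarrow> distr M (count_space UNIV) (\<xi> n) = distr M (count_space UNIV) (\<xi> 1)"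
begin

definition initial_word :: "nat \<Rightarrow> 'w \<Rightarrow> 'a list" where
  "initial_word n \<omega> = map (\<lambda>k. \<xi> k \<omega>) [1..<Suc n]"

lemma length_initial_word [simp]: "length (initial_word n \<omega>) = n"
  by (simp add: initial_word_def)

lemma take_initial_word: "m \<le> n \<Longrightarrow> take m (initial_word n \<omega>) = initial_word m \<omega>"
  by (simp add: initial_word_def take_map take_upt del: upt_Suc)

lemma measurable_letter: "n \<ge> 1 \<Longrightarrow> \<xi> n \<in> measurable M (count_space UNIV)"
  using indep by (auto simp: indep_vars_def2)

lemma prob_letter:
  assumes "n \<ge> 1"
  shows "prob {\<omega> \<in> space M. \<xi> n \<omega> = a} = prob {\<omega> \<in> space M. \<xi> 1 \<omega> = a}"
proof -
  have "prob {\<omega> \<in> space M. \<xi> k \<omega> = a} = measure (distr M (count_space UNIV) (\<xi> k)) {a}"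
    if "k \<ge> 1" for k
    using measure_distr[OF measurable_letter[OF that], of "{a}"]
    by (simp add: vimage_def Int_def conj_commute)
  from this[OF assms] this[of 1] show ?thesis by (simp add: ident[OF assms])
qed

text \<open>Independence factors the probability of reading \<open>w\<close> letter by letter; every later probability
  is a sum of such word weights.\<close>

lemma initial_word_event [measurable]: "{\<omega> \<in> space M. initial_word n \<omega> = w} \<in> events"
  and prob_initial_word:
    "length w = n \<Longrightarrow> prob {\<omega> \<in> space M. initial_word n \<omega> = w} = word_prob M \<xi> w"
proof -
  have *: "{\<omega> \<in> space M. initial_word n \<omega> = w} \<in> events \<and>
    prob {\<omega> \<in> space M. initial_word n \<omega> = w} = word_prob M \<xi> w" if len: "length w = n"
  proof (cases "n = 0")
    case True
    then show ?thesis using len by (simp add: initial_word_def word_prob_def prob_space)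
  next
    case False
    have eq: "{\<omega> \<in> space M. initial_word n \<omega> = w} = (\<Inter>k\<in>{1..n}. \<xi> k -` {w ! (k - 1)} \<inter> space M)"
      (is "_ = ?I")
    proof -
      have "initial_word n \<omega> = w \<longleftrightarrow> (\<forall>k\<in>{1..n}. \<xi> k \<omega> = w ! (k - 1))" for \<omega>
      proof -
        have "initial_word n \<omega> = w \<longleftrightarrow> (\<forall>k<n. \<xi> (Suc k) \<omega> = w ! k)"
          using len by (auto simp: list_eq_iff_nth_eq initial_word_def simp del: upt_Suc)
        also have "\<dots> \<longleftrightarrow> (\<forall>k\<in>{1..n}. \<xi> k \<omega> = w ! (k - 1))"
          unfolding image_Suc_lessThan[symmetric] by auto
        finally show ?thesis .
      qed
      then show ?thesis using False by auto
    qed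
    have "?I \<in> events"
      using False by (intro sets.finite_INT) (auto intro!: measurable_sets[OF measurable_letter])
    moreover have "prob ?I = (\<Prod>k\<in>{1..n}. prob (\<xi> k -` {w ! (k - 1)} \<inter> space M))"
      by (rule indep_varsD[OF indep]) (use False in auto)
    moreover have "\<dots> = (\<Prod>k\<in>{1..n}. prob {\<omega> \<in> space M. \<xi> 1 \<omega> = w ! (k - 1)})"
    proof (rule prod.cong[OF refl])
      fix k assume "k \<in> {1..n}"
      then show "prob (\<xi> k -` {w ! (k - 1)} \<inter> space M) = prob {\<omega> \<in> space M. \<xi> 1 \<omega> = w ! (k - 1)}"
        using prob_letter[of k "w ! (k - 1)"] by (simp add: vimage_def Int_def conj_commute)
    qed
    moreover have "\<dots> = word_prob M \<xi> w"
      unfolding word_prob_def len image_Suc_lessThan[symmetric] by (simp add: prod.reindex)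
    ultimately show ?thesis unfolding eq by simp
  qed
  show "{\<omega> \<in> space M. initial_word n \<omega> = w} \<in> events"
  proof (cases "length w = n")
    case False
    then have empty: "{\<omega> \<in> space M. initial_word n \<omega> = w} = {}" by auto
    show ?thesis unfolding empty by simp
  qed (use * in blast)
  show "prob {\<omega> \<in> space M. initial_word n \<omega> = w} = word_prob M \<xi> w" if "length w = n"
    using * that by blast
qed

lemma prob_initial_word_in:
  assumes "finite S" "\<And>w. w \<in> S \<Longrightarrow> length w = n"
  shows "prob {\<omega> \<in> space M. initial_word n \<omega> \<in> S} = (\<Sum>w\<in>S. word_prob M \<xi> w)"
proof -
  have "{\<omega> \<in> space M. initial_word n \<omega> \<in> S} = (\<Union>w\<in>S. {\<omega> \<in> space M. initial_word n \<omega> = w})"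
    by auto
  moreover have "prob (\<Union>w\<in>S. {\<omega> \<in> space M. initial_word n \<omega> = w}) =
      (\<Sum>w\<in>S. prob {\<omega> \<in> space M. initial_word n \<omega> = w})"
    using assms(1) by (intro finite_measure_finite_Union) (auto simp: disjoint_family_on_def)
  ultimately show ?thesis using assms(2) by (simp add: prob_initial_word)
qed

lemma word_prob_Cons:
  "word_prob M \<xi> (a # v) = prob {\<omega> \<in> space M. \<xi> 1 \<omega> = a} * word_prob M \<xi> v"
  by (simp add: word_prob_def prod.lessThan_Suc_shift del: prod.lessThan_Suc)

lemma word_prob_append: "word_prob M \<xi> (u @ v) = word_prob M \<xi> u * word_prob M \<xi> v"
  by (induction u) (simp_all add: word_prob_Cons word_prob_def[of _ _ "[]"])

lemma sum_word_prob_letters: "(\<Sum>a\<in>UNIV. word_prob M \<xi> [a]) = 1"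
proof -
  have "prob {\<omega> \<in> space M. initial_word 1 \<omega> \<in> range (\<lambda>a. [a])} = (\<Sum>w\<in>range (\<lambda>a. [a]). word_prob M \<xi> w)"
    by (rule prob_initial_word_in) auto
  also have "\<dots> = (\<Sum>a\<in>UNIV. word_prob M \<xi> [a])" by (simp add: sum.reindex inj_on_def)
  also have "{\<omega> \<in> space M. initial_word 1 \<omega> \<in> range (\<lambda>a. [a])} = space M"
    by (auto simp: initial_word_def)
  finally show ?thesis by (simp add: prob_space)
qed

lemma le_pattern_time_iff:
  "enat n \<le> pattern_time \<xi> B \<omega> \<longleftrightarrow> (\<forall>m<n. \<not> suffix B (initial_word m \<omega>))"
proof -
  have "length B \<le> m \<and> map (\<lambda>k. \<xi> k \<omega>) [m - length B + 1..<m + 1] = B \<longleftrightarrow>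
      suffix B (initial_word m \<omega>)" for m
  proof -
    have "drop (m - length B) (initial_word m \<omega>) = map (\<lambda>k. \<xi> k \<omega>) [m - length B + 1..<m + 1]"
      by (simp add: initial_word_def drop_map drop_upt del: upt_Suc)
    moreover have "suffix B w \<longleftrightarrow> length B \<le> length w \<and> drop (length w - length B) w = B" for w
      by (metis suffix_drop suffix_length_le suffix_take append_eq_conv_conj length_take min.absorb2 diff_le_self)
    ultimately show ?thesis by simp
  qed
  then show ?thesis unfolding pattern_time_def le_INF_iff by (auto simp: not_less)
qed

text \<open>The two events whose probabilities are the coefficients of the generating functions depend on
  the first \<open>n\<close> letters only.\<close>

lemma less_first_pattern_time_iff:
  "enat n < first_pattern_time \<xi> A \<omega> \<longleftrightarrow> initial_word n \<omega> \<in> avoiding_words A n"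
proof -
  have "enat n < first_pattern_time \<xi> A \<omega> \<longleftrightarrow> (\<forall>i. enat (Suc n) \<le> pattern_time \<xi> (A i) \<omega>)"
    by (simp add: first_pattern_time_def Suc_ile_eq)
  also have "\<dots> \<longleftrightarrow> (\<forall>m\<le>n. \<forall>i. \<not> suffix (A i) (initial_word m \<omega>))"
    by (auto simp: le_pattern_time_iff less_Suc_eq_le)
  finally show ?thesis
    by (auto simp: avoiding_words_def avoids_iff_prefixes take_initial_word)
qed

lemma tail_prob_eq_sum: "tail_prob M \<xi> A n = (\<Sum>w\<in>avoiding_words A n. word_prob M \<xi> w)"
  unfolding tail_prob_def less_first_pattern_time_iff
  by (rule prob_initial_word_in) (simp_all add: avoiding_words_def finite_words)

lemma tail_gf_sums:
  "norm s < 1 \<Longrightarrow> (\<lambda>n. of_real (tail_prob M \<xi> A n) * s ^ n) sums tail_gf M \<xi> A s"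
  unfolding tail_gf_def by (intro summable_sums summable_gf) (simp_all add: tail_prob_def)

lemma pattern_gf_sums:
  "norm s < 1 \<Longrightarrow> (\<lambda>n. of_real (first_pattern_prob M \<xi> A j n) * s ^ n) sums pattern_gf M \<xi> A j s"
  unfolding pattern_gf_def
  by (intro summable_sums summable_gf) (simp_all add: first_pattern_prob_def)

context
  fixes A :: "'m::finite \<Rightarrow> 'a list"
  assumes nonempty: "\<And>i. A i \<noteq> []"
begin

lemma first_pattern_time_eq_iff:
  "first_pattern_time \<xi> A \<omega> = pattern_time \<xi> (A j) \<omega> \<and> pattern_time \<xi> (A j) \<omega> = enat n \<longleftrightarrow>
    initial_word n \<omega> \<in> first_hit_words A j n"
proof -
  let ?\<tau> = "first_pattern_time \<xi> A \<omega>" and ?\<tau>j = "pattern_time \<xi> (A j) \<omega>"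
  have le: "?\<tau> \<le> ?\<tau>j" by (simp add: first_pattern_time_def)
  have butlast: "butlast (initial_word n \<omega>) = initial_word (n - 1) \<omega>"
    by (simp add: butlast_conv_take take_initial_word)
  \<comment> \<open>For \<open>n = 0\<close> both sides hold, since no pattern is empty.\<close>
  have ge: "enat n \<le> ?\<tau> \<longleftrightarrow> avoids A (butlast (initial_word n \<omega>))"
  proof (cases n)
    case 0
    then show ?thesis using nonempty by (simp add: zero_enat_def[symmetric] initial_word_def avoids_def)
  next
    case (Suc m)
    then show ?thesis
      using less_first_pattern_time_iff[where n = m and A = A and \<omega> = \<omega>] butlast by (simp add: Suc_ile_eq avoiding_words_def)
  qed
  have "?\<tau> = ?\<tau>j \<and> ?\<tau>j = enat n \<longleftrightarrow> enat n \<le> ?\<tau> \<and> \<not> enat (Suc n) \<le> ?\<tau>j"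
    using le by (auto simp: Suc_ile_eq)
  also have "\<dots> \<longleftrightarrow> enat n \<le> ?\<tau> \<and> suffix (A j) (initial_word n \<omega>)"
  proof -
    have "\<forall>m<n. \<not> suffix (A j) (initial_word m \<omega>)" if "enat n \<le> ?\<tau>"
      using le_pattern_time_iff[of n "A j" \<omega>] order_trans[OF that le] by simp
    then show ?thesis by (auto simp: le_pattern_time_iff less_Suc_eq)
  qed
  finally show ?thesis unfolding ge by (auto simp: first_hit_words_def)
qed

lemma first_pattern_prob_eq_sum:
  "first_pattern_prob M \<xi> A j n = (\<Sum>w\<in>first_hit_words A j n. word_prob M \<xi> w)"
  unfolding first_pattern_prob_def first_pattern_time_eq_iff
  by (rule prob_initial_word_in) (simp_all add: first_hit_words_def finite_words)

lemma tail_prob_0: "tail_prob M \<xi> A 0 = 1"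
proof -
  have "avoiding_words A 0 = {[]}" using nonempty by (auto simp: avoiding_words_def avoids_def)
  then show ?thesis by (simp add: tail_prob_eq_sum word_prob_def)
qed

lemma first_pattern_prob_short: "n < length (A j) \<Longrightarrow> first_pattern_prob M \<xi> A j n = 0"
  by (simp add: first_pattern_prob_eq_sum first_hit_words_short)

context
  assumes reduced: "reduced_patterns A"
begin

text \<open>Both sides are the weight of the avoiding words of length \<open>n\<close> extended by one arbitrary
  letter; on the left, the weights of the letters add up to \<open>1\<close>.\<close>

lemma tail_prob_step:
  "tail_prob M \<xi> A n = tail_prob M \<xi> A (Suc n) + (\<Sum>j\<in>UNIV. first_pattern_prob M \<xi> A j (Suc n))"
proof -
  let ?P = "word_prob M \<xi>"
  have "tail_prob M \<xi> A n = (\<Sum>u\<in>avoiding_words A n. \<Sum>a\<in>UNIV. ?P (u @ [a]))"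
    by (simp add: word_prob_append sum_word_prob_letters tail_prob_eq_sum flip: sum_distrib_left)
  also have "\<dots> = (\<Sum>w\<in>(\<lambda>(u, a). u @ [a]) ` (avoiding_words A n \<times> UNIV). ?P w)"
    by (simp add: sum.cartesian_product sum.reindex inj_on_def case_prod_unfold)
  also have "\<dots> = (\<Sum>w\<in>avoiding_words A (Suc n) \<union> (\<Union>j. first_hit_words A j (Suc n)). ?P w)"
    by (simp only: one_letter_extension)
  also have "\<dots> = (\<Sum>w\<in>avoiding_words A (Suc n). ?P w) + (\<Sum>w\<in>(\<Union>j. first_hit_words A j (Suc n)). ?P w)"
    by (rule sum.union_disjoint) (simp_all add: Int_UN_distrib one_letter_extension_disjoint)
  also have "(\<Sum>w\<in>(\<Union>j. first_hit_words A j (Suc n)). ?P w) = (\<Sum>j\<in>UNIV. \<Sum>w\<in>first_hit_words A j (Suc n). ?P w)"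
    by (rule sum.UNION_disjoint) (use first_hit_words_disjoint[OF reduced] in auto)
  finally show ?thesis by (simp add: tail_prob_eq_sum first_pattern_prob_eq_sum)
qed

text \<open>Both sides are the weight of the avoiding words of length \<open>n\<close> followed by \<open>A i\<close>, on the right
  classified by the first pattern that is completed.\<close>

lemma word_prob_times_tail_prob:
  "word_prob M \<xi> (A i) * tail_prob M \<xi> A n =
    (\<Sum>j\<in>UNIV. \<Sum>k\<in>overlaps (A i) (A j).
       word_prob M \<xi> (drop k (A i)) * first_pattern_prob M \<xi> A j (n + k))"
proof -
  let ?P = "word_prob M \<xi>"
  let ?I = "SIGMA j:UNIV. overlaps (A i) (A j)"
  let ?F = "\<lambda>(j, k). (\<lambda>w. w @ drop k (A i)) ` first_hit_words A j (n + k)"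
  have fin: "finite (overlaps (A i) (A j))" for j by (simp add: overlaps_def)
  have "?P (A i) * tail_prob M \<xi> A n = (\<Sum>u\<in>avoiding_words A n. ?P (u @ A i))"
    by (simp add: tail_prob_eq_sum word_prob_append sum_distrib_left mult.commute)
  also have "\<dots> = (\<Sum>x\<in>(\<lambda>u. u @ A i) ` avoiding_words A n. ?P x)"
    by (simp add: sum.reindex inj_on_def)
  also have "\<dots> = (\<Sum>x\<in>(\<Union>p\<in>?I. ?F p). ?P x)"
    by (simp only: pattern_extension[OF reduced])
  also have "\<dots> = (\<Sum>p\<in>?I. \<Sum>x\<in>?F p. ?P x)"
  proof (rule sum.UNION_disjoint)
    show "finite ?I" using fin by (intro finite_SigmaI) auto
    show "\<forall>p\<in>?I. finite (?F p)" by auto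
    show "\<forall>p\<in>?I. \<forall>q\<in>?I. p \<noteq> q \<longrightarrow> ?F p \<inter> ?F q = {}"
      using pattern_extension_disjoint[OF reduced] by fast
  qed
  also have "\<dots> = (\<Sum>(j, k)\<in>?I. ?P (drop k (A i)) * first_pattern_prob M \<xi> A j (n + k))"
    by (intro sum.cong refl)
      (auto simp: sum.reindex inj_on_def word_prob_append first_pattern_prob_eq_sum
        sum_distrib_left mult.commute)
  also have "\<dots> = (\<Sum>j\<in>UNIV. \<Sum>k\<in>overlaps (A i) (A j).
       ?P (drop k (A i)) * first_pattern_prob M \<xi> A j (n + k))"
    by (rule sum.Sigma[symmetric]) (use fin in auto)
  finally show ?thesis .
qed

section \<open>The linear system and its solution\<close>

text \<open>Dropping the first \<open>k\<close> terms loses nothing, since \<open>A j\<close> needs at least \<open>k\<close> letters.\<close>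

lemma pattern_gf_shift_sums:
  assumes "norm s < 1" "k \<le> length (A j)"
  shows "(\<lambda>n. of_real (first_pattern_prob M \<xi> A j (n + k)) * s ^ (n + k)) sums pattern_gf M \<xi> A j s"
  using pattern_gf_sums[OF assms(1), where A = A and j = j] assms(2)
  by (subst sums_zero_iff_shift) (simp_all add: first_pattern_prob_short)

text \<open>The first equation is \<open>tail_prob_step\<close> multiplied by \<open>s^(n+1)\<close> and summed over \<open>n\<close>; the others
  are \<open>word_prob_times_tail_prob\<close> multiplied by \<open>s^(n+l)\<close>, with \<open>l\<close> the length of \<open>A i\<close>. In the
  latter the power splits as \<open>s^(l-k) * s^(n+k)\<close>, into the factor of the correlation polynomial and
  the factor of the generating function.\<close>

lemma gf_solves_guibas_odlyzko_system:
  assumes s: "norm s < 1"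
  shows "guibas_odlyzko_system M \<xi> A s (tail_gf M \<xi> A s) (\<lambda>i. pattern_gf M \<xi> A i s)"
  unfolding guibas_odlyzko_system_def
proof (intro conjI allI)
  let ?q = "\<lambda>n. complex_of_real (tail_prob M \<xi> A n)"
  let ?p = "\<lambda>j n. complex_of_real (first_pattern_prob M \<xi> A j n)"
  let ?Q = "tail_gf M \<xi> A s" and ?g = "\<lambda>j. pattern_gf M \<xi> A j s"
  have "(\<lambda>n. ?q (Suc n) * s ^ Suc n) sums (?Q - 1)"
    using tail_gf_sums[OF s] by (subst sums_Suc_iff) (simp add: tail_prob_0)
  moreover have "(\<lambda>n. \<Sum>j\<in>UNIV. ?p j (n + 1) * s ^ (n + 1)) sums (\<Sum>j\<in>UNIV. ?g j)"
    using nonempty by (intro sums_sum pattern_gf_shift_sums[OF s]) (simp add: Suc_le_eq)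
  ultimately have "(\<lambda>n. ?q (Suc n) * s ^ Suc n + (\<Sum>j\<in>UNIV. ?p j (n + 1) * s ^ (n + 1)))
      sums (?Q - 1 + (\<Sum>j\<in>UNIV. ?g j))"
    by (rule sums_add)
  moreover have "?q (Suc n) * s ^ Suc n + (\<Sum>j\<in>UNIV. ?p j (n + 1) * s ^ (n + 1)) = s * (?q n * s ^ n)" for n
    by (simp add: tail_prob_step[of n] algebra_simps sum_distrib_left)
  moreover have "(\<lambda>n. s * (?q n * s ^ n)) sums (s * ?Q)"
    by (rule sums_mult[OF tail_gf_sums[OF s]])
  ultimately have "?Q - 1 + (\<Sum>j\<in>UNIV. ?g j) = s * ?Q" by (simp add: sums_unique2)
  then show "(1 - s) * ?Q + (\<Sum>j\<in>UNIV. ?g j) = 1" by (simp add: algebra_simps)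
  fix i
  let ?P = "\<lambda>w. complex_of_real (word_prob M \<xi> w)" and ?l = "length (A i)"
  have "(\<lambda>n. \<Sum>j\<in>UNIV. \<Sum>k\<in>overlaps (A i) (A j).
        ?P (drop k (A i)) * s ^ (?l - k) * (?p j (n + k) * s ^ (n + k)))
      sums (\<Sum>j\<in>UNIV. \<Sum>k\<in>overlaps (A i) (A j). ?P (drop k (A i)) * s ^ (?l - k) * ?g j)"
    by (intro sums_sum sums_mult pattern_gf_shift_sums[OF s]) (auto simp: overlaps_def)
  moreover have "(\<Sum>j\<in>UNIV. \<Sum>k\<in>overlaps (A i) (A j).
        ?P (drop k (A i)) * s ^ (?l - k) * (?p j (n + k) * s ^ (n + k))) =
      ?P (A i) * s ^ ?l * (?q n * s ^ n)" for n
  proof -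
    have "s ^ (?l - k) * s ^ (n + k) = s ^ (?l + n)" if "k \<in> overlaps (A i) (A j)" for j k
      using that by (auto simp: overlaps_def simp flip: power_add)
    then have "(\<Sum>j\<in>UNIV. \<Sum>k\<in>overlaps (A i) (A j).
        ?P (drop k (A i)) * s ^ (?l - k) * (?p j (n + k) * s ^ (n + k))) =
      (\<Sum>j\<in>UNIV. \<Sum>k\<in>overlaps (A i) (A j). ?P (drop k (A i)) * ?p j (n + k) * s ^ (?l + n))"
      by (intro sum.cong refl) (simp add: mult_ac)
    also have "\<dots> = of_real (word_prob M \<xi> (A i) * tail_prob M \<xi> A n) * s ^ (?l + n)"
      by (simp add: word_prob_times_tail_prob flip: sum_distrib_right)
    finally show ?thesis by (simp add: power_add mult_ac)
  qed
  moreover have "(\<lambda>n. ?P (A i) * s ^ ?l * (?q n * s ^ n)) sums (?P (A i) * s ^ ?l * ?Q)"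
    by (rule sums_mult[OF tail_gf_sums[OF s]])
  ultimately show "?P (A i) * s ^ ?l * ?Q - (\<Sum>j\<in>UNIV. corr_poly M \<xi> (A i) (A j) s * ?g j) = 0"
    by (simp add: corr_poly_eq_sum_overlaps sum_distrib_right sums_unique2)
qed

end

end

end

text \<open>At \<open>0\<close> only the monomial of degree \<open>0\<close> survives. It belongs to \<open>k = length B\<close>, and is present
  only if \<open>B\<close> is a final block of the other pattern.\<close>

lemma corr_poly_diag_0: "B \<noteq> [] \<Longrightarrow> corr_poly M \<xi> B B 0 = 1"
  and corr_poly_0: "\<not> sublist B C \<Longrightarrow> corr_poly M \<xi> B C 0 = 0"
proof -
  have "corr_poly M \<xi> B C 0 =
      (\<Sum>k = 1..min (length B) (length C). of_bool (k = length B \<and> B = last_letters k C))" for C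
    unfolding corr_poly_def
    by (intro sum.cong refl) (auto simp: first_letters_def last_letters_def word_prob_def power_0_left)
  note eq = this
  show "corr_poly M \<xi> B B 0 = 1" if "B \<noteq> []"
  proof -
    have "corr_poly M \<xi> B B 0 = (\<Sum>k\<in>{length B}. 1)"
      unfolding eq by (intro sum.mono_neutral_cong_right) (use that in \<open>auto simp: last_letters_def Suc_le_eq\<close>)
    then show ?thesis by simp
  qed
  show "corr_poly M \<xi> B C 0 = 0" if "\<not> sublist B C"
  proof -
    have "B \<noteq> last_letters k C" for k
      using that by (auto simp: last_letters_def)
    then show ?thesis unfolding eq by simp
  qed
qed

lemma continuous_on_det [continuous_intros]:
  fixes F :: "'t::topological_space \<Rightarrow> complex ^ 'm ^ 'm::finite"
  assumes "\<And>i j. continuous_on S (\<lambda>s. F s $ i $ j)"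
  shows "continuous_on S (\<lambda>s. det (F s))"
  unfolding det_def by (intro continuous_intros assms)

lemma continuous_on_corr_poly [continuous_intros]: "continuous_on S (\<lambda>s. corr_poly M \<xi> B C s)"
  unfolding corr_poly_def by (intro continuous_intros)

lemma continuous_on_det_corr_matrix:
  "continuous_on S (\<lambda>s. det (corr_matrix M \<xi> A s))"
  "continuous_on S (\<lambda>s. det (corr_matrix_replaced M \<xi> A j s))"
proof -
  show "continuous_on S (\<lambda>s. det (corr_matrix M \<xi> A s))"
    by (intro continuous_on_det) (simp add: corr_matrix_def continuous_on_corr_poly)
  show "continuous_on S (\<lambda>s. det (corr_matrix_replaced M \<xi> A j s))"
  proof (intro continuous_on_det)
    fix i k
    show "continuous_on S (\<lambda>s. corr_matrix_replaced M \<xi> A j s $ i $ k)"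
      by (cases "k = j")
        (auto simp: corr_matrix_replaced_def corr_matrix_def intro!: continuous_intros)
  qed
qed

lemma det_corr_matrix_0:
  assumes "\<And>i. A i \<noteq> []" "reduced_patterns A"
  shows "det (corr_matrix M \<xi> A 0) = 1"
proof -
  have "corr_matrix M \<xi> A 0 = mat 1"
    using assms by (auto simp: vec_eq_iff corr_matrix_def mat_def reduced_patterns_def
        corr_poly_diag_0 corr_poly_0)
  then show ?thesis by simp
qed

lemma det_corr_matrix_replaced_0:
  assumes "\<And>i. A i \<noteq> []"
  shows "det (corr_matrix_replaced M \<xi> A j 0) = 0"
  by (rule det_zero_column(1)[of j]) (use assms in \<open>simp add: column_def corr_matrix_replaced_def vec_eq_iff\<close>)

text \<open>Cramer's rule for \<open>B g = Q v\<close> expresses \<open>g\<close> through \<open>Q\<close>, and the first equation of the system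
  then determines \<open>Q\<close>. This applies to an arbitrary solution, hence it also yields uniqueness.\<close>

lemma guibas_odlyzko_system_cramer:
  assumes sys: "guibas_odlyzko_system M \<xi> A s Q g"
    and det: "det (corr_matrix M \<xi> A s) \<noteq> 0"
    and D: "D = (\<Sum>j\<in>UNIV. det (corr_matrix_replaced M \<xi> A j s)) + (1 - s) * det (corr_matrix M \<xi> A s)"
    and D0: "D \<noteq> 0"
  shows "Q = det (corr_matrix M \<xi> A s) / D" "g i = det (corr_matrix_replaced M \<xi> A i s) / D"
proof -
  let ?B = "corr_matrix M \<xi> A s" and ?R = "\<lambda>j. corr_matrix_replaced M \<xi> A j s"
  let ?v = "\<lambda>i. of_real (word_prob M \<xi> (A i)) * s ^ length (A i)"
  have cramer: "g j * det ?B = Q * det (?R j)" for j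
  proof -
    have rhs: "(?B *v (\<chi> j. g j)) $ i = Q * ?v i" for i
      using sys by (simp add: guibas_odlyzko_system_def matrix_vector_mult_def corr_matrix_def mult_ac)
    have "g j * det ?B = det (\<chi> i k. if k = j then Q * ?v i else ?B $ i $ k)"
      using cramer_lemma[of j ?B "\<chi> j. g j"] by (simp add: rhs cong: if_cong)
    \<comment> \<open>Transposing turns the \<open>j\<close>-th column into a row, from which the scalar \<open>Q\<close> can be taken out.\<close>
    also have "\<dots> = det (\<chi> k. if k = j then Q *s (\<chi> i. ?v i) else column k ?B)"
      by (subst det_transpose[symmetric], rule arg_cong[of _ _ det])
        (auto simp: vec_eq_iff transpose_def column_def)
    also have "\<dots> = Q * det (\<chi> k. if k = j then (\<chi> i. ?v i) else column k ?B)"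
      by (rule det_row_mul)
    also have "(\<chi> k. if k = j then (\<chi> i. ?v i) else column k ?B) = transpose (?R j)"
      by (auto simp: vec_eq_iff transpose_def column_def corr_matrix_replaced_def)
    finally show ?thesis by (simp add: det_transpose)
  qed
  have "det ?B = ((1 - s) * Q + (\<Sum>j\<in>UNIV. g j)) * det ?B"
    using sys by (simp add: guibas_odlyzko_system_def)
  also have "\<dots> = Q * D"
    by (simp add: D cramer algebra_simps sum_distrib_left flip: sum_distrib_right)
      (simp add: cramer sum_distrib_left sum_distrib_right)
  finally show Q: "Q = det ?B / D" using D0 by (simp add: field_simps)
  show "g i = det (?R i) / D" using cramer[of i] det D0 unfolding Q by (simp add: field_simps)
qed

theorem theorem2p3:
  fixes M :: "'w measure"
    and \<xi> :: "nat \<Rightarrow> 'w \<Rightarrow> 'a::finite"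
    and A :: "'m::finite \<Rightarrow> 'a list"
  assumes "prob_space M"
    and "prob_space.indep_vars M (\<lambda>_. count_space UNIV) \<xi> {1..}"
    and "\<And>n. n \<ge> 1 \<Longrightarrow>
           distr M (count_space UNIV) (\<xi> n) = distr M (count_space UNIV) (\<xi> 1)"
    and "\<And>i. A i \<noteq> []"
    and "reduced_patterns A"
  shows "\<forall>\<^sub>F s in nhds (0::complex).
    (\<forall>Q g. guibas_odlyzko_system M \<xi> A s Q g \<longleftrightarrow>
             Q = tail_gf M \<xi> A s \<and> g = (\<lambda>i. pattern_gf M \<xi> A i s)) \<and>
    (\<Sum>j\<in>UNIV. det (corr_matrix_replaced M \<xi> A j s)) + (1 - s) * det (corr_matrix M \<xi> A s) \<noteq> 0 \<and>
    (\<forall>i. pattern_gf M \<xi> A i s =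
       det (corr_matrix_replaced M \<xi> A i s) /
       ((\<Sum>j\<in>UNIV. det (corr_matrix_replaced M \<xi> A j s)) + (1 - s) * det (corr_matrix M \<xi> A s))) \<and>
    tail_gf M \<xi> A s =
       det (corr_matrix M \<xi> A s) /
       ((\<Sum>j\<in>UNIV. det (corr_matrix_replaced M \<xi> A j s)) + (1 - s) * det (corr_matrix M \<xi> A s))"
proof -
  interpret iid_letters M \<xi>
    by (intro iid_letters.intro iid_letters_axioms.intro assms(1-3))
  define D where "D s = (\<Sum>j\<in>UNIV. det (corr_matrix_replaced M \<xi> A j s)) +
      (1 - s) * det (corr_matrix M \<xi> A s)" for s
  have "open {s. D s \<noteq> 0}" "open {s. det (corr_matrix M \<xi> A s) \<noteq> 0}"
    unfolding D_def by (intro open_Collect_neq continuous_intros continuous_on_det_corr_matrix)+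
  moreover have "D 0 \<noteq> 0" "det (corr_matrix M \<xi> A 0) \<noteq> 0"
    using assms(4,5) by (simp_all add: D_def det_corr_matrix_0 det_corr_matrix_replaced_0)
  ultimately have "\<forall>\<^sub>F s in nhds 0. D s \<noteq> 0" "\<forall>\<^sub>F s in nhds 0. det (corr_matrix M \<xi> A s) \<noteq> 0"
    using eventually_nhds_in_open by force+
  moreover have "\<forall>\<^sub>F s in nhds (0::complex). s \<in> ball 0 1"
    by (rule eventually_nhds_in_open) auto
  ultimately show ?thesis
  proof eventually_elim
    case (elim s)
    have sol: "guibas_odlyzko_system M \<xi> A s (tail_gf M \<xi> A s) (\<lambda>i. pattern_gf M \<xi> A i s)"
      using gf_solves_guibas_odlyzko_system[OF assms(4,5)] elim by simp
    note formulas = guibas_odlyzko_system_cramer[OF _ elim(2) D_def elim(1)]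
    have "Q = tail_gf M \<xi> A s \<and> g = (\<lambda>i. pattern_gf M \<xi> A i s)"
      if "guibas_odlyzko_system M \<xi> A s Q g" for Q g
      using formulas[OF that] formulas[OF sol] by auto
    then show ?case using sol formulas[OF sol] elim(1) unfolding D_def by blast
  qed
qed

end
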